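(* Let $\mathsf{F}(t)=\sum_{n=0}^\infty \mathcal{F}_n\frac{t^n}{n!}$ be the exponential generating function of the Fibonacci-Fubini numbers. For every integer $r\ge 1$, its $r$th derivative is $$\mathsf{F}^{(r)}(t)= \frac{1}{\sqrt{5}} \sum_{i=1}^{r}e^{it}{r \brace i} \left(\alpha^{i+1} e^{\alpha (e^t-1)}-\beta^{i+1} e^{\beta (e^t-1)}\right).$$
   Context: $\alpha=(1+\sqrt5)/2$ and $\beta=(1-\sqrt5)/2$. ${r\brace i}$ denotes the Stirling number of the second kind (the number of partitions of an $r$-element set into exactly $i$ non-empty blocks). The identity is one of formal power series in $t$, with derivative taken with respect to $t$. A permutation $\sigma=\sigma_1\cdots\sigma_k$ of $\{1,\dots,k\}$ is a Fibonacci permutation if $|\sigma_i-i|\le 1$ for every $i$. For a set partition of $[n]=\{1,\dots,n\}$ into non-empty blocks $B_1|B_2|\cdots|B_k$, the blocks are always listed so that $\min B_1<\min B_2<\cdots<\min B_k$. A Fibonacci ordered partition of $[n]$ is an arrangement $B_{\sigma_1}|B_{\sigma_2}|\cdots|B_{\sigma_k}$ where $B_1|\cdots|B_k$ is a partition of $[n]$ (any number $k$ of blocks) and $\sigma$ is a Fibonacci permutation of $\{1,\dots,k\}$. The Fibonacci-Fubini number $\mathcal{F}_n$ is the total number of Fibonacci ordered partitions of $[n]$ (for $n=0$ the empty partition with $k=0$ blocks is counted once, so $\mathcal{F}_0=1$). *)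

theory Defs
  imports
    Complex_Main
    "HOL-Library.Disjoint_Sets"
    "HOL-Combinatorics.Permutations"
    "HOL-Combinatorics.Stirling"
    "HOL-Computational_Algebra.Formal_Power_Series"
begin

definition fibonacci_permutation :: "nat \<Rightarrow> (nat \<Rightarrow> nat) \<Rightarrow> bool" where
  "fibonacci_permutation k \<sigma> \<longleftrightarrow>
     \<sigma> permutes {1..k} \<and> (\<forall>i\<in>{1..k}. \<bar>int (\<sigma> i) - int i\<bar> \<le> 1)"

definition standard_block_list :: "nat \<Rightarrow> nat set list \<Rightarrow> bool" where
  "standard_block_list n Bs \<longleftrightarrow>
     partition_on {1..n} (set Bs) \<and> sorted_wrt (\<lambda>A B. Min A < Min B) Bs"

text \<open>Block \<open>B\<^sub>i\<close> is \<open>Bs ! (i - 1)\<close>, since permutations act on \<open>{1..k}\<close> while lists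
  are indexed from \<open>0\<close>.\<close>

definition arrange_blocks :: "nat set list \<Rightarrow> (nat \<Rightarrow> nat) \<Rightarrow> nat set list" where
  "arrange_blocks Bs \<sigma> = map (\<lambda>i. Bs ! (\<sigma> i - 1)) [1..<Suc (length Bs)]"

definition fibonacci_ordered_partitions :: "nat \<Rightarrow> nat set list set" where
  "fibonacci_ordered_partitions n =
     {arrange_blocks Bs \<sigma> | Bs \<sigma>.
        standard_block_list n Bs \<and> fibonacci_permutation (length Bs) \<sigma>}"

definition fibonacci_fubini :: "nat \<Rightarrow> nat" where
  "fibonacci_fubini n = card (fibonacci_ordered_partitions n)"

definition fibonacci_fubini_egf :: "real fps" where
  "fibonacci_fubini_egf = Abs_fps (\<lambda>n. of_nat (fibonacci_fubini n) / fact n)"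

definition golden_alpha :: real where
  "golden_alpha = (1 + sqrt 5) / 2"

definition golden_beta :: real where
  "golden_beta = (1 - sqrt 5) / 2"

text \<open>The recursively defined \<^const>\<open>Stirling\<close> counts set partitions into a given number of
  non-empty blocks.\<close>

lemma card_partitions_insert:
  fixes A :: "'a set"
  assumes A: "finite A" and a: "a \<notin> A"
  shows "card {P. partition_on (insert a A) P \<and> card P = Suc k} =
         Suc k * card {P. partition_on A P \<and> card P = Suc k} + card {P. partition_on A P \<and> card P = k}"
proof -
  define Parts where "Parts = (\<lambda>j. {P. partition_on A P \<and> card P = j})"
  define ext where "ext = (\<lambda>(Q, B). insert (insert a B) (Q - {B :: 'a set}))"
  have fin_blocks: "finite Q" if "partition_on A Q" for Q
    using finite_elements[OF A that] .
  have fin: "finite (Parts j)" for j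
    unfolding Parts_def using finitely_many_partition_on[OF A] by (rule rev_finite_subset) auto
  have not_in: "a \<notin> C" if "Q \<in> Parts j" "C \<in> Q" for Q C j
    using that a unfolding Parts_def partition_on_def by auto
  have dec1: "P \<in> insert {a} ` Parts k"
    if P: "partition_on (insert a A) P" "card P = Suc k" and aP: "{a} \<in> P" for P
  proof -
    have dis: "disjnt {a} (\<Union>(P - {{a}}))"
      using P(1) aP pairwiseD[of disjnt P "{a}"] by (auto simp: partition_on_def)
    have "P = insert {a} (P - {{a}})"
      using aP by auto
    then have "partition_on (insert a A - {a}) (P - {{a}})"
      using P(1) partition_on_insert[OF dis, of "insert a A"] by simp
    then have "P - {{a}} \<in> Parts k"
      using a P(2) aP by (simp add: Parts_def)
    then show ?thesis
      using \<open>P = _\<close> by blast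
  qed
  have dec2: "P \<in> ext ` (SIGMA Q:Parts (Suc k). Q)"
    if P: "partition_on (insert a A) P" "card P = Suc k" and aP: "{a} \<notin> P" for P
  proof -
    obtain C where C: "C \<in> P" "a \<in> C"
      using P(1) by (auto simp: partition_on_def)
    define B where "B = C - {a}"
    define Q where "Q = insert B (P - {C})"
    have C_eq: "C = insert a B" "a \<notin> B"
      using C by (auto simp: B_def)
    have B: "B \<noteq> {}"
      using C aP C_eq by auto
    have un: "\<Union>P = insert a A" and dj: "\<And>X Y. X \<in> P \<Longrightarrow> Y \<in> P \<Longrightarrow> X \<noteq> Y \<Longrightarrow> disjnt X Y"
      and ne: "{} \<notin> P"
      using P(1) by (auto simp: partition_on_def pairwise_def)
    have other: "a \<notin> X" if "X \<in> P" "X \<noteq> C" for X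
      using dj[OF that(1) C(1) that(2)] C(2) by (auto simp: disjnt_iff)
    have B_notin: "B \<notin> P"
    proof
      assume "B \<in> P"
      then have "disjnt B C"
        using dj C C_eq by blast
      then show False
        using B C_eq by (auto simp: disjnt_iff)
    qed
    have "\<Union>(P - {C}) \<union> C = insert a A"
      using un C(1) by auto
    moreover have "a \<notin> \<Union>(P - {C})"
      using other by blast
    moreover have "V \<union> (C - {a}) = A" if "V \<union> C = insert a A" "a \<notin> V" for V
      using a that by auto
    ultimately have "\<Union>(P - {C}) \<union> B = A"
      unfolding B_def by blast
    then have "\<Union>Q = A"
      unfolding Q_def Union_insert by (simp only: Un_commute)
    moreover have "disjoint Q"
    proof (rule pairwiseI)
      fix X Y assume XY: "X \<in> Q" "Y \<in> Q" "X \<noteq> Y"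
      have disB: "disjnt B Z" if "Z \<in> P - {C}" for Z
        using dj[of C Z] that C C_eq by (auto simp: disjnt_iff)
      consider "X = B" "Y \<in> P - {C}" | "Y = B" "X \<in> P - {C}" | "X \<in> P" "Y \<in> P"
        using XY unfolding Q_def by blast
      then show "disjnt X Y"
      proof cases
        case 1
        then show ?thesis using disB by simp
      next
        case 2
        then show ?thesis using disB by (simp add: disjnt_sym)
      next
        case 3
        then show ?thesis using dj XY(3) by simp
      qed
    qed
    ultimately have "partition_on A Q"
      using ne B by (auto simp: partition_on_def Q_def)
    moreover have "finite P"
      by (rule card_ge_0_finite) (simp add: P(2))
    then have "card Q = Suc k"
      using P(2) C(1) B_notin by (simp add: Q_def)
    moreover have "P = ext (Q, B)"
      using C C_eq B_notin by (auto simp: ext_def Q_def)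
    moreover have "B \<in> Q"
      by (simp add: Q_def)
    ultimately show ?thesis
      unfolding Parts_def by (intro image_eqI[of _ _ "(Q, B)"]) simp_all
  qed
  have con1: "partition_on (insert a A) (insert {a} Q) \<and> card (insert {a} Q) = Suc k"
    if Q: "Q \<in> Parts k" for Q
  proof -
    have dis: "disjnt {a} (\<Union>Q)"
      using not_in[OF Q] by (auto simp: disjnt_iff)
    have "{a} \<notin> Q"
      using not_in[OF Q] by blast
    then show ?thesis
      using partition_on_insert[OF dis, of "insert a A"] Q a fin_blocks
      by (simp add: Parts_def)
  qed
  have con2: "partition_on (insert a A) (ext (Q, B)) \<and> card (ext (Q, B)) = Suc k \<and> {a} \<notin> ext (Q, B)"
    if Q: "Q \<in> Parts (Suc k)" and B: "B \<in> Q" for Q B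
  proof -
    have un: "\<Union>Q = A" and dj: "\<And>X Y. X \<in> Q \<Longrightarrow> Y \<in> Q \<Longrightarrow> X \<noteq> Y \<Longrightarrow> disjnt X Y"
      and ne: "{} \<notin> Q" and card: "card Q = Suc k" and finQ: "finite Q"
      using Q fin_blocks by (auto simp: Parts_def partition_on_def pairwise_def)
    have disB: "disjnt B Z" if "Z \<in> Q - {B}" for Z
      using dj[of B Z] that B by auto
    have dis: "disjnt (insert a B) (\<Union>(Q - {B}))"
      using disB not_in[OF Q] by (auto simp: disjnt_iff)
    have "\<Union>(Q - {B}) \<union> B = A"
      using un B by auto
    then have "\<Union>(Q - {B}) = insert a A - insert a B"
      using disB a by (auto simp: disjnt_iff)
    then have "partition_on (insert a A - insert a B) (Q - {B})"
      using dj ne by (auto simp: partition_on_def pairwise_def)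
    moreover have "insert a B \<subseteq> insert a A"
      using un B by auto
    ultimately have "partition_on (insert a A) (ext (Q, B))"
      using partition_on_insert[OF dis, of "insert a A"] by (simp add: ext_def)
    moreover have "insert a B \<notin> Q"
      using not_in[OF Q] by blast
    then have "card (ext (Q, B)) = Suc k"
      using finQ B card by (simp add: ext_def)
    moreover have "\<not> B \<subseteq> {a}" "{a} \<notin> Q"
      using not_in[OF Q] B ne by (auto simp: subset_singleton_iff)
    then have "{a} \<notin> ext (Q, B)"
      by (auto simp: ext_def)
    ultimately show ?thesis
      by blast
  qed
  have split: "{P. partition_on (insert a A) P \<and> card P = Suc k} =
      insert {a} ` Parts k \<union> ext ` (SIGMA Q:Parts (Suc k). Q)" (is "?L = ?R")
  proof
    show "?L \<subseteq> ?R"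
      using dec1 dec2 by blast
    show "?R \<subseteq> ?L"
      using con1 con2 by blast
  qed
  have inj1: "inj_on (insert {a}) (Parts k)"
  proof (rule inj_onI)
    fix Q Q' assume QQ: "Q \<in> Parts k" "Q' \<in> Parts k" and eq: "insert {a} Q = insert {a} Q'"
    have "{a} \<notin> Q" "{a} \<notin> Q'"
      using not_in[OF QQ(1)] not_in[OF QQ(2)] by blast+
    then show "Q = Q'"
      using eq by (metis insert_ident)
  qed
  have inj2: "inj_on ext (SIGMA Q:Parts (Suc k). Q)"
  proof (rule inj_onI, clarify)
    fix Q B Q' B'
    assume Q: "Q \<in> Parts (Suc k)" "B \<in> Q" and Q': "Q' \<in> Parts (Suc k)" "B' \<in> Q'"
      and eq: "ext (Q, B) = ext (Q', B')"
    have eq': "insert (insert a B) (Q - {B}) = insert (insert a B') (Q' - {B'})"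
      using eq by (simp add: ext_def)
    have nQ: "a \<notin> C" if "C \<in> Q" for C using not_in[OF Q(1) that] .
    have nQ': "a \<notin> C" if "C \<in> Q'" for C using not_in[OF Q'(1) that] .
    have "insert a B \<in> insert (insert a B') (Q' - {B'})"
      using eq' by blast
    then have ins: "insert a B = insert a B'"
      using nQ' by blast
    then have B: "B = B'"
      using nQ[OF Q(2)] nQ'[OF Q'(2)] by (metis insert_ident)
    moreover have "insert a B \<notin> Q - {B}" "insert a B \<notin> Q' - {B'}"
      using nQ nQ' by blast+
    then have "Q - {B} = Q' - {B'}"
      using eq' B by (metis insert_ident)
    ultimately show "Q = Q' \<and> B = B'"
      using Q(2) Q'(2) by (metis insert_Diff)
  qed
  have "insert {a} ` Parts k \<inter> ext ` (SIGMA Q:Parts (Suc k). Q) = {}"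
    using con2 by blast
  moreover have "finite (SIGMA Q:Parts (Suc k). Q)"
    using fin fin_blocks by (auto simp: Parts_def intro!: finite_SigmaI)
  ultimately have "card {P. partition_on (insert a A) P \<and> card P = Suc k} =
      card (Parts k) + card (SIGMA Q:Parts (Suc k). Q)"
    using fin by (simp add: split card_Un_disjoint card_image inj1 inj2)
  also have "card (SIGMA Q:Parts (Suc k). Q) = (\<Sum>Q\<in>Parts (Suc k). card Q)"
    using fin fin_blocks by (intro card_SigmaI) (auto simp: Parts_def)
  also have "\<dots> = (\<Sum>Q\<in>Parts (Suc k). Suc k)"
    by (rule sum.cong) (auto simp: Parts_def)
  finally show ?thesis
    by (simp add: Parts_def)
qed

lemma card_partitions_eq_Stirling:
  assumes "finite A"
  shows "card {P. partition_on A P \<and> card P = k} = Stirling (card A) k"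
  using assms
proof (induction A arbitrary: k rule: finite_induct)
  case empty
  have "{P. P = ({} :: 'a set set) \<and> card P = k} = (if k = 0 then {{}} else {})"
    by auto
  then show ?case
    by (cases k) (simp_all add: partition_on_empty)
next
  case (insert a A)
  show ?case
  proof (cases k)
    case 0
    have "card P \<noteq> 0" if "partition_on (insert a A) P" for P
      using that finite_elements[OF _ that] insert.hyps by (auto simp: partition_on_def)
    then have none: "{P. partition_on (insert a A) P \<and> card P = 0} = {}"
      by blast
    show ?thesis
      unfolding 0 none using insert.hyps by simp
  next
    case (Suc j)
    then show ?thesis
      using insert by (simp add: card_partitions_insert)
  qed
qed

end

theory Submission
  imports Defs "HOL-Number_Theory.Fib"
begin

text \<open>
  A Fibonacci permutation of \<open>{1..k}\<close> either fixes \<open>k\<close> or swaps \<open>k\<close> with \<open>k - 1\<close>, so there are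
  \<open>fib (k + 1)\<close> of them and \<open>\<F>\<^sub>n\<close> is the sum of \<open>Stirling n k * fib (k + 1)\<close> over \<open>k\<close>.
  The series \<open>H\<^sub>c = exp (c (e\<^sup>t - 1))\<close> has \<open>r\<close>-th derivative \<open>\<Sum>i\<le>r. Stirling r i c\<^sup>i e\<^bsup>it\<^esup> H\<^sub>c\<close>; its
  value at \<open>0\<close> gives the coefficients of \<open>H\<^sub>c\<close>, and Binet's formula turns them into
  \<open>\<F>(t) = (\<alpha> H\<^sub>\<alpha> - \<beta> H\<^sub>\<beta>) / \<surd>5\<close>, to which the derivative formula applies again.
\<close>

section \<open>Fibonacci permutations\<close>

text \<open>If \<open>k + 2\<close> is moved, both its image and its preimage must be
  \<open>k + 1\<close>, its only neighbour in the range. The two are then swapped, and undoing the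
  swap leaves a permutation of \<open>{1..k}\<close>.\<close>

lemma fibonacci_permutation_Suc_Suc:
  "{\<sigma>. fibonacci_permutation (Suc (Suc k)) \<sigma>} =
     {\<sigma>. fibonacci_permutation (Suc k) \<sigma>} \<union>
     (\<lambda>\<sigma>. \<sigma> \<circ> transpose (Suc k) (Suc (Suc k))) ` {\<sigma>. fibonacci_permutation k \<sigma>}"
  (is "?L = ?A \<union> ?t ` ?B")
proof (intro equalityI subsetI)
  let ?n = "Suc (Suc k)"
  fix \<sigma> assume "\<sigma> \<in> ?L"
  then have perm: "\<sigma> permutes {1..?n}" and near: "\<And>i. i \<in> {1..?n} \<Longrightarrow> \<bar>int (\<sigma> i) - int i\<bar> \<le> 1"
    by (auto simp: fibonacci_permutation_def)
  have "\<sigma> ?n \<in> {1..?n}"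
    using permutes_in_image[OF perm] by simp
  then consider "\<sigma> ?n = ?n" | "\<sigma> ?n = Suc k"
    using near[of ?n] by fastforce
  then show "\<sigma> \<in> ?A \<union> ?t ` ?B"
  proof cases
    case 1
    have "\<sigma> permutes {1..Suc k}"
      by (rule permutes_superset[OF perm]) (use 1 in \<open>auto simp: le_Suc_eq\<close>)
    then show ?thesis
      using near by (simp add: fibonacci_permutation_def)
  next
    case 2
    obtain j where j: "\<sigma> j = ?n"
      using permutes_surj[OF perm] by (metis surjD)
    then have "j \<in> {1..?n}"
      using permutes_in_image[OF perm, of j] by simp
    then have "j = ?n \<or> j = Suc k"
      using near[of j] j by fastforce
    then have swap: "\<sigma> (Suc k) = ?n"
      using j 2 by auto
    define \<tau> where "\<tau> = ?t \<sigma>"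
    have \<tau>: "\<tau> ?n = ?n" "\<tau> (Suc k) = Suc k" "\<And>i. i \<le> k \<Longrightarrow> \<tau> i = \<sigma> i"
      using 2 swap by (auto simp: \<tau>_def transpose_def)
    have "\<tau> permutes {1..?n}"
      unfolding \<tau>_def by (intro permutes_compose perm permutes_swap_id) auto
    then have "\<tau> permutes {1..k}"
      by (rule permutes_superset) (use \<tau> in \<open>auto simp: le_Suc_eq\<close>)
    then have "\<tau> \<in> ?B"
      using near \<tau>(3) by (simp add: fibonacci_permutation_def)
    moreover have "\<sigma> = ?t \<tau>"
      by (simp add: \<tau>_def comp_assoc)
    ultimately show ?thesis
      by blast
  qed
next
  let ?n = "Suc (Suc k)"
  fix \<sigma> assume "\<sigma> \<in> ?A \<union> ?t ` ?B"
  then consider "\<sigma> \<in> ?A" | \<tau> where "\<tau> \<in> ?B" "\<sigma> = ?t \<tau>"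
    by blast
  then show "\<sigma> \<in> ?L"
  proof cases
    case 1
    then have perm: "\<sigma> permutes {1..Suc k}"
      by (simp add: fibonacci_permutation_def)
    then have "\<sigma> ?n = ?n"
      by (rule permutes_not_in) simp
    then have "\<forall>i\<in>{1..?n}. \<bar>int (\<sigma> i) - int i\<bar> \<le> 1"
      using 1 by (auto simp: fibonacci_permutation_def le_Suc_eq)
    moreover have "\<sigma> permutes {1..?n}"
      by (rule permutes_subset[OF perm]) simp
    ultimately show ?thesis
      by (simp add: fibonacci_permutation_def)
  next
    case 2
    then have perm: "\<tau> permutes {1..k}"
      by (simp add: fibonacci_permutation_def)
    have "\<tau> (Suc k) = Suc k" "\<tau> ?n = ?n"
      using perm by (auto intro: permutes_not_in)
    then have \<sigma>: "\<sigma> ?n = Suc k" "\<sigma> (Suc k) = ?n" "\<And>i. i \<le> k \<Longrightarrow> \<sigma> i = \<tau> i"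
      using 2 by (auto simp: transpose_def)
    then have "\<forall>i\<in>{1..?n}. \<bar>int (\<sigma> i) - int i\<bar> \<le> 1"
      using 2 by (auto simp: fibonacci_permutation_def le_Suc_eq)
    moreover have "\<tau> permutes {1..?n}"
      by (rule permutes_subset[OF perm]) simp
    then have "\<sigma> permutes {1..?n}"
      unfolding 2(2) by (intro permutes_compose permutes_swap_id) auto
    ultimately show ?thesis
      by (simp add: fibonacci_permutation_def)
  qed
qed

lemma finite_fibonacci_permutations: "finite {\<sigma>. fibonacci_permutation k \<sigma>}"
  by (rule finite_subset[OF _ finite_permutations[of "{1..k}"]])
     (auto simp: fibonacci_permutation_def)

text \<open>The decomposition above is the Fibonacci recurrence. The index is shifted because
  \<open>k = 0\<close> and \<open>k = 1\<close> each admit only the identity, matching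
  \<open>fib 1 = fib 2 = 1\<close>.\<close>

lemma card_fibonacci_permutations: "card {\<sigma>. fibonacci_permutation k \<sigma>} = fib (Suc k)"
proof (induction k rule: fib.induct)
  case 1
  have "{\<sigma>. fibonacci_permutation 0 \<sigma>} = {id}"
    by (auto simp: fibonacci_permutation_def)
  then show ?case
    by simp
next
  case 2
  have "{\<sigma>. fibonacci_permutation (Suc 0) \<sigma>} = {id}"
    by (auto simp: fibonacci_permutation_def)
  then show ?case
    by simp
next
  case (3 k)
  let ?n = "Suc (Suc k)"
  let ?A = "{\<sigma>. fibonacci_permutation (Suc k) \<sigma>}"
  let ?B = "{\<sigma>. fibonacci_permutation k \<sigma>}"
  let ?t = "\<lambda>\<sigma> :: nat \<Rightarrow> nat. \<sigma> \<circ> transpose (Suc k) ?n"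
  \<comment> \<open>Composing with a transposition is its own inverse.\<close>
  have inj: "inj_on ?t ?B"
    by (rule inj_on_inverseI[of _ ?t]) (simp add: comp_assoc)
  \<comment> \<open>The value at \<open>?n\<close> tells the two pieces apart.\<close>
  have "\<sigma> ?n = ?n" if "\<sigma> \<in> ?A" for \<sigma>
    using that by (auto simp: fibonacci_permutation_def intro: permutes_not_in)
  moreover have "?t \<sigma> ?n = Suc k" if "\<sigma> \<in> ?B" for \<sigma>
    using that by (auto simp: fibonacci_permutation_def intro: permutes_not_in)
  ultimately have "?A \<inter> ?t ` ?B = {}"
    by fastforce
  then show ?case
    using 3 by (simp add: fibonacci_permutation_Suc_Suc card_Un_disjoint card_image[OF inj]
        finite_fibonacci_permutations)
qed

section \<open>Fibonacci ordered partitions\<close>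

lemma standard_block_list_distinct:
  assumes "standard_block_list n Bs"
  shows "distinct Bs"
proof -
  have "sorted_wrt (<) (map Min Bs)"
    using assms by (simp add: standard_block_list_def sorted_wrt_map)
  then show ?thesis
    by (metis distinct_map strict_sorted_iff)
qed

text \<open>A non-empty finite block contains its minimum, so blocks with equal minima meet and
  hence coincide.\<close>

lemma inj_on_Min_partition:
  fixes P :: "nat set set"
  assumes "partition_on A P" "finite A"
  shows "inj_on Min P"
proof (rule inj_onI)
  fix B C assume BC: "B \<in> P" "C \<in> P" "Min B = Min C"
  have "finite X \<and> X \<noteq> {}" if "X \<in> P" for X
    using assms that by (metis partition_onD1 partition_onD3 Sup_upper finite_subset)
  then have "Min B \<in> B \<inter> C"
    using BC by (metis IntI Min_in)
  then show "B = C"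
    using assms(1) BC by (metis partition_onD2 disjointD empty_iff)
qed

text \<open>Both lists of minima are strictly increasing with the same elements, hence equal, and
  each block is determined by its minimum.\<close>

lemma standard_block_list_unique:
  assumes "standard_block_list n Bs" "standard_block_list n Cs" "set Bs = set Cs"
  shows "Bs = Cs"
proof -
  have "map Min Bs = map Min Cs"
    using assms by (intro strict_sorted_equal) (auto simp: standard_block_list_def sorted_wrt_map)
  moreover have "inj_on Min (set Bs \<union> set Cs)"
    using assms inj_on_Min_partition[of "{1..n}" "set Bs"] by (simp add: standard_block_list_def)
  ultimately show ?thesis
    by (rule map_inj_on)
qed

lemma standard_block_list_exists:
  assumes "partition_on {1..n} P"
  obtains Bs where "standard_block_list n Bs" "set Bs = P"
proof -
  have inj: "inj_on Min P"
    using assms by (rule inj_on_Min_partition) simp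
  have "finite P"
    using finite_elements[OF _ assms] by simp
  \<comment> \<open>Sort the minima, then replace each one by the block it comes from.\<close>
  define ms where "ms = sorted_list_of_set (Min ` P)"
  define Bs where "Bs = map (the_inv_into P Min) ms"
  have ms: "set ms = Min ` P"
    using \<open>finite P\<close> by (simp add: ms_def)
  have "set Bs = the_inv_into P Min ` Min ` P"
    by (simp add: Bs_def ms)
  also have "\<dots> = P"
    using the_inv_into_onto[OF inj] .
  finally have set: "set Bs = P" .
  have "map Min Bs = ms"
    using ms by (auto simp: Bs_def f_the_inv_into_f[OF inj] intro!: map_idI)
  moreover have "sorted_wrt (<) ms"
    by (simp add: ms_def)
  ultimately have "sorted_wrt (<) (map Min Bs)"
    by simp
  then have "standard_block_list n Bs"
    using assms set by (simp add: standard_block_list_def sorted_wrt_map)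
  then show ?thesis
    using set that by blast
qed

text \<open>Turns sums over standard lists into sums over partitions, which Stirling numbers
  count.\<close>

lemma bij_betw_standard_block_lists:
  "bij_betw set {Bs. standard_block_list n Bs} {P. partition_on {1..n} P}"
  unfolding bij_betw_def
proof
  show "inj_on set {Bs. standard_block_list n Bs}"
    using standard_block_list_unique by (auto intro: inj_onI)
  show "set ` {Bs. standard_block_list n Bs} = {P. partition_on {1..n} P}"
    using standard_block_list_exists by (fastforce simp: standard_block_list_def)
qed

lemma nth_arrange_blocks:
  assumes "i \<in> {1..length Bs}"
  shows "arrange_blocks Bs \<sigma> ! (i - 1) = Bs ! (\<sigma> i - 1)"
  using assms by (auto simp: arrange_blocks_def simp del: upt_Suc)

lemma set_arrange_blocks:
  assumes "\<sigma> permutes {1..length Bs}"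
  shows "set (arrange_blocks Bs \<sigma>) = set Bs"
proof -
  have "set (arrange_blocks Bs \<sigma>) = (\<lambda>j. Bs ! (j - 1)) ` \<sigma> ` {1..length Bs}"
    unfolding arrange_blocks_def image_image
    by (simp add: atLeastLessThanSuc_atLeastAtMost del: upt_Suc)
  also have "\<dots> = (\<lambda>j. Bs ! (j - 1)) ` Suc ` {0..<length Bs}"
    unfolding permutes_image[OF assms] image_Suc_atLeastLessThan
    by (simp add: atLeastLessThanSuc_atLeastAtMost)
  also have "\<dots> = set Bs"
    by (simp only: image_image diff_Suc_1 nth_image[of "length Bs" Bs, simplified])
  finally show ?thesis .
qed

text \<open>Rearranging keeps the set of blocks, which determines the standard list. As its entries
  are distinct, the block at each position then reveals the value of the permutation there.\<close>

lemma arrange_blocks_inject: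
  assumes Bs: "standard_block_list n Bs" and Cs: "standard_block_list n Cs"
    and \<sigma>: "\<sigma> permutes {1..length Bs}" and \<tau>: "\<tau> permutes {1..length Cs}"
    and eq: "arrange_blocks Bs \<sigma> = arrange_blocks Cs \<tau>"
  shows "Bs = Cs \<and> \<sigma> = \<tau>"
proof
  show *: "Bs = Cs"
    using Bs Cs eq set_arrange_blocks[OF \<sigma>] set_arrange_blocks[OF \<tau>]
    by (metis standard_block_list_unique)
  show "\<sigma> = \<tau>"
  proof
    fix i
    show "\<sigma> i = \<tau> i"
    proof (cases "i \<in> {1..length Bs}")
      case True
      then have "Bs ! (\<sigma> i - 1) = Bs ! (\<tau> i - 1)"
        using eq * nth_arrange_blocks by metis
      \<comment> \<open>Both values are at least 1, so the truncated subtraction of 1 can be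
        cancelled.\<close>
      moreover have "\<sigma> i \<in> {1..length Bs}" "\<tau> i \<in> {1..length Bs}"
        using True * permutes_in_image[OF \<sigma>] permutes_in_image[OF \<tau>] by auto
      ultimately show ?thesis
        using nth_eq_iff_index_eq[OF standard_block_list_distinct[OF Bs], of "\<sigma> i - 1" "\<tau> i - 1"]
        by (simp add: Suc_le_eq) linarith
    next
      case False
      then show ?thesis
        using * \<sigma> \<tau> by (metis permutes_not_in)
    qed
  qed
qed

text \<open>By injectivity it suffices to count pairs of a standard list and a permutation; grouping
  the partitions by their number of blocks gives the sum.\<close>

lemma fibonacci_fubini_eq:
  "fibonacci_fubini n = (\<Sum>k\<le>n. Stirling n k * fib (Suc k))"
proof -
  let ?S = "{Bs. standard_block_list n Bs}"
  let ?P = "{P. partition_on {1..n} P}"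
  let ?F = "\<lambda>Bs :: nat set list. {\<sigma>. fibonacci_permutation (length Bs) \<sigma>}"
  have finP: "finite ?P"
    by (rule finitely_many_partition_on) simp
  have finS: "finite ?S"
    using bij_betw_finite[OF bij_betw_standard_block_lists] finP by blast
  \<comment> \<open>The minima of the blocks are distinct elements of \<open>{1..n}\<close>.\<close>
  have le: "card P \<le> n" if "P \<in> ?P" for P
  proof -
    have P: "partition_on {1..n} P"
      using that by simp
    have "inj_on Min P"
      using P by (rule inj_on_Min_partition) simp
    moreover have "finite X \<and> X \<noteq> {} \<and> X \<subseteq> {1..n}" if "X \<in> P" for X
      using P that by (metis partition_onD1 partition_onD3 Sup_upper finite_subset finite_atLeastAtMost)
    then have "Min ` P \<subseteq> {1..n}"
      by (meson Min_in image_subsetI subsetD)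
    ultimately show ?thesis
      using card_inj_on_le[of Min P "{1..n}"] by simp
  qed
  have "fibonacci_ordered_partitions n = (\<lambda>(Bs, \<sigma>). arrange_blocks Bs \<sigma>) ` (SIGMA Bs:?S. ?F Bs)"
    by (auto simp: fibonacci_ordered_partitions_def)
  moreover have "inj_on (\<lambda>(Bs, \<sigma>). arrange_blocks Bs \<sigma>) (SIGMA Bs:?S. ?F Bs)"
    by (rule inj_onI)
       (use arrange_blocks_inject in \<open>fastforce simp: fibonacci_permutation_def\<close>)
  ultimately have "fibonacci_fubini n = card (SIGMA Bs:?S. ?F Bs)"
    by (simp add: fibonacci_fubini_def card_image)
  also have "\<dots> = (\<Sum>Bs\<in>?S. fib (Suc (length Bs)))"
    using finS by (simp add: finite_fibonacci_permutations card_fibonacci_permutations del: fib.simps)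
  \<comment> \<open>Rewritten so that the summand depends only on the underlying partition.\<close>
  also have "\<dots> = (\<Sum>Bs\<in>?S. fib (Suc (card (set Bs))))"
    by (intro sum.cong) (auto dest: standard_block_list_distinct simp: distinct_card simp del: fib.simps)
  also have "\<dots> = (\<Sum>P\<in>?P. fib (Suc (card P)))"
    by (rule sum.reindex_bij_betw[OF bij_betw_standard_block_lists])
  also have "\<dots> = (\<Sum>k\<le>n. \<Sum>P\<in>{P \<in> ?P. card P = k}. fib (Suc (card P)))"
    using finP le by (intro sum.group[symmetric]) auto
  also have "\<dots> = (\<Sum>k\<le>n. Stirling n k * fib (Suc k))"
    using card_partitions_eq_Stirling[of "{1..n}"] by (simp del: fib.simps)
  finally show ?thesis .
qed

section \<open>The generating function\<close>

text \<open>Absorbs the factor e^t produced by differentiating the composite into the index.\<close>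

lemma fps_exp_of_nat_Suc:
  "fps_exp (of_nat (Suc i)) = fps_exp 1 * fps_exp (of_nat i :: 'a :: field_char_0)"
  by (simp add: fps_exp_add_mult)

text \<open>Each term \<open>T i\<close> = e^(it) c^i H has derivative
  \<open>of_nat i * T i + T (Suc i)\<close>, so the coefficients follow the Stirling
  recurrence.\<close>

lemma fps_nth_deriv_exp_exp:
  fixes c :: "'a :: field_char_0"
  defines "H \<equiv> fps_exp c oo (fps_exp 1 - 1)"
  shows "fps_nth_deriv r H =
    (\<Sum>i\<le>r. fps_exp (of_nat i) * of_nat (Stirling r i) * (fps_const (c ^ i) * H))"
proof (induction r)
  case 0
  show ?case by simp
next
  case (Suc r)
  let ?E = "\<lambda>i. fps_exp (of_nat i :: 'a)"
  have dH: "fps_deriv H = fps_const c * fps_exp 1 * H"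
    by (simp add: H_def fps_compose_deriv fps_compose_mult_distrib mult_ac)
  define T where "T = (\<lambda>i. ?E i * (fps_const (c ^ i) * H))"
  have dT: "fps_deriv (T i) = of_nat i * T i + T (Suc i)" for i
    by (simp add: T_def dH fps_exp_of_nat_Suc fps_of_nat algebra_simps del: of_nat_Suc
        flip: fps_const_mult)
  have "fps_nth_deriv (Suc r) H = fps_deriv (\<Sum>i\<le>r. of_nat (Stirling r i) * T i)"
    using Suc by (simp only: fps_nth_deriv_commute T_def mult_ac)
  also have "\<dots> = (\<Sum>i\<le>r. of_nat (Stirling r i) * fps_deriv (T i))"
    by (simp add: fps_deriv_sum)
  also have "\<dots> = (\<Sum>i\<le>r. of_nat (i * Stirling r i) * T i) + (\<Sum>i\<le>r. of_nat (Stirling r i) * T (Suc i))"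
    by (simp add: dT algebra_simps sum.distrib)
  \<comment> \<open>The added term vanishes since \<open>Stirling r (Suc r) = 0\<close>. The term at
    0 has factor 0, so the index can then be shifted to match the other sum.\<close>
  also have "(\<Sum>i\<le>r. of_nat (i * Stirling r i) * T i) =
      (\<Sum>i\<le>Suc r. of_nat (i * Stirling r i) * T i)"
    by simp
  also have "\<dots> = (\<Sum>i\<le>r. of_nat (Suc i * Stirling r (Suc i)) * T (Suc i))"
    by (subst sum.atMost_Suc_shift) simp
  also have "\<dots> + (\<Sum>i\<le>r. of_nat (Stirling r i) * T (Suc i)) =
      (\<Sum>i\<le>r. of_nat (Stirling (Suc r) (Suc i)) * T (Suc i))"
    by (simp add: algebra_simps flip: sum.distrib)
  \<comment> \<open>The term at 0 returns with coefficient
    \<open>Stirling (Suc r) 0 = 0\<close>.\<close>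
  also have "\<dots> = (\<Sum>i\<le>Suc r. of_nat (Stirling (Suc r) i) * T i)"
    by (subst sum.atMost_Suc_shift) simp
  finally show ?case
    by (simp only: T_def mult_ac)
qed

text \<open>The numerator is the Touchard polynomial in \<open>c\<close>, read off as the
  \<open>n\<close>-th derivative at 0.\<close>

lemma fps_nth_exp_exp:
  fixes c :: "'a :: field_char_0"
  shows "fps_nth (fps_exp c oo (fps_exp 1 - 1)) n = (\<Sum>k\<le>n. of_nat (Stirling n k) * c ^ k) / fact n"
proof -
  let ?H = "fps_exp c oo (fps_exp 1 - 1)"
  have "fact n * fps_nth ?H n = fps_nth (fps_nth_deriv n ?H) 0"
    by (simp add: fps_deriv_maclauren_0)
  \<comment> \<open>Every exponential factor and \<open>?H\<close> itself have constant term
    1.\<close>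
  also have "\<dots> = (\<Sum>k\<le>n. of_nat (Stirling n k) * c ^ k)"
    by (simp add: fps_nth_deriv_exp_exp fps_sum_nth)
  finally show ?thesis
    by (simp add: field_simps)
qed

text \<open>The exponent in Binet's formula for \<open>fib (Suc k)\<close> exceeds \<open>k\<close>
  by one; the surplus power is the factor in front of each composite.\<close>

lemma fibonacci_fubini_egf_eq:
  "fibonacci_fubini_egf = fps_const (1 / sqrt 5) *
     (fps_const golden_alpha * (fps_exp golden_alpha oo (fps_exp 1 - 1)) -
      fps_const golden_beta * (fps_exp golden_beta oo (fps_exp 1 - 1)))"
proof (rule fps_ext)
  fix n
  have "real (fibonacci_fubini n) =
      (\<Sum>k\<le>n. real (Stirling n k) * ((golden_alpha ^ Suc k - golden_beta ^ Suc k) / sqrt 5))"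
    unfolding fibonacci_fubini_eq of_nat_sum of_nat_mult fib_closed_form
      golden_alpha_def golden_beta_def ..
  also have "\<dots> = (golden_alpha * (\<Sum>k\<le>n. real (Stirling n k) * golden_alpha ^ k) -
      golden_beta * (\<Sum>k\<le>n. real (Stirling n k) * golden_beta ^ k)) / sqrt 5"
    by (simp add: sum_distrib_left sum_divide_distrib algebra_simps diff_divide_distrib
        flip: sum_subtractf)
  finally show "fps_nth fibonacci_fubini_egf n = fps_nth (fps_const (1 / sqrt 5) *
     (fps_const golden_alpha * (fps_exp golden_alpha oo (fps_exp 1 - 1)) -
      fps_const golden_beta * (fps_exp golden_beta oo (fps_exp 1 - 1)))) n"
    by (simp add: fibonacci_fubini_egf_def fps_nth_exp_exp field_simps)
qed

theorem theorem7:
  fixes r :: nat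
  assumes "r \<ge> 1"
  shows "fps_nth_deriv r fibonacci_fubini_egf =
    fps_const (1 / sqrt 5) *
      (\<Sum>i = 1..r. fps_exp (of_nat i) * of_nat (Stirling r i) *
        (fps_const (golden_alpha ^ (i + 1)) * (fps_exp golden_alpha oo (fps_exp 1 - 1)) -
         fps_const (golden_beta ^ (i + 1)) * (fps_exp golden_beta oo (fps_exp 1 - 1))))"
proof -
  let ?H = "\<lambda>c :: real. fps_exp c oo (fps_exp 1 - 1)"
  let ?S = "\<lambda>i. fps_exp (of_nat i) * of_nat (Stirling r i) :: real fps"
  \<comment> \<open>This is why the sum may start at \<open>i = 1\<close>.\<close>
  have "Stirling r 0 = 0"
    using assms by (cases r) auto
  \<comment> \<open>The leading factor \<open>c\<close> raises the exponent to
    \<open>i + 1\<close>.\<close>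
  then have H: "fps_const c * fps_nth_deriv r (?H c) =
      (\<Sum>i = 1..r. ?S i * (fps_const (c ^ (i + 1)) * ?H c))" for c
    by (simp add: fps_nth_deriv_exp_exp atMost_atLeast0 sum.atLeast_Suc_atMost sum_distrib_left
        mult_ac flip: fps_const_mult)
  show ?thesis
    unfolding fibonacci_fubini_egf_eq fps_nth_deriv_mult_const_left fps_nth_deriv_sub H
    by (simp only: right_diff_distrib sum_subtractf)
qed

end
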